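(* For every integer $n\ge 2$, the commuting graph $\Delta(SD_{8n})$ is perfect.
   Context: For an integer $n\ge 2$, the semidihedral group is $SD_{8n}=\langle a,b : a^{4n}=b^2=e,\ ba=a^{2n-1}b\rangle$, a group of order $8n$. The commuting graph $\Delta(G)$ of a group $G$ is the simple graph with vertex set $G$ in which two distinct vertices $x,y$ are adjacent iff $xy=yx$. A graph $\Gamma$ is perfect if $\omega(\Gamma')=\chi(\Gamma')$ for every induced subgraph $\Gamma'$ of $\Gamma$, where $\omega$ is the clique number and $\chi$ the chromatic number. *)

theory Defs
  imports "HOL-Algebra.Coset" "HOL-Library.Extended_Nat" "Graph_Theory.Graph_Theory"
begin

section \<open>Groups given by generators and relations\<close>

text \<open>
  A word is a list of letters \<open>(x, s)\<close>; \<open>(x, True)\<close> stands for the generator \<open>x\<close> and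
  \<open>(x, False)\<close> for its formal inverse. The generators are all elements of the type \<open>'g\<close>.
\<close>

type_synonym 'g word = "('g \<times> bool) list"

inductive pres_eq :: "('g word \<times> 'g word) set \<Rightarrow> 'g word \<Rightarrow> 'g word \<Rightarrow> bool"
  for R where
  pres_rel: "(u, v) \<in> R \<Longrightarrow> pres_eq R u v"
| pres_cancel: "pres_eq R [(x, s), (x, \<not> s)] []"
| pres_refl: "pres_eq R u u"
| pres_sym: "pres_eq R u v \<Longrightarrow> pres_eq R v u"
| pres_trans: "pres_eq R u v \<Longrightarrow> pres_eq R v w \<Longrightarrow> pres_eq R u w"
| pres_append: "pres_eq R u u' \<Longrightarrow> pres_eq R v v' \<Longrightarrow> pres_eq R (u @ v) (u' @ v')"

definition word_class :: "('g word \<times> 'g word) set \<Rightarrow> 'g word \<Rightarrow> 'g word set" where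
  "word_class R u = {v. pres_eq R u v}"

definition presented_group :: "('g word \<times> 'g word) set \<Rightarrow> 'g word set monoid" where
  "presented_group R =
    \<lparr> carrier = range (word_class R),
      monoid.mult = (\<lambda>X Y. \<Union>x\<in>X. \<Union>y\<in>Y. word_class R (x @ y)),
      monoid.one = word_class R [] \<rparr>"

lemma word_class_eq_iff: "word_class R u = word_class R v \<longleftrightarrow> pres_eq R u v"
  unfolding word_class_def
  by (metis (no_types, lifting) Collect_cong mem_Collect_eq pres_refl pres_sym pres_trans)

lemma presented_group_carrier: "carrier (presented_group R) = range (word_class R)"
  and presented_group_one: "\<one>\<^bsub>presented_group R\<^esub> = word_class R []"
  by (simp_all add: presented_group_def)

lemma presented_group_mult:
  "word_class R u \<otimes>\<^bsub>presented_group R\<^esub> word_class R v = word_class R (u @ v)"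
proof -
  have "word_class R (x @ y) = word_class R (u @ v)"
    if "x \<in> word_class R u" "y \<in> word_class R v" for x y
    using that by (simp add: word_class_eq_iff) (simp add: word_class_def pres_append pres_sym)
  moreover have "u \<in> word_class R u" "v \<in> word_class R v"
    by (simp_all add: word_class_def pres_refl)
  ultimately have "(\<Union>x\<in>word_class R u. \<Union>y\<in>word_class R v. word_class R (x @ y)) =
      word_class R (u @ v)"
    by blast
  then show ?thesis
    by (simp add: presented_group_def)
qed

lemma pres_left_inverse:
  "pres_eq R (rev (map (\<lambda>(x, s). (x, \<not> s)) u) @ u) []"
proof (induction u)
  case Nil
  show ?case by (simp add: pres_refl)
next
  case (Cons l u)
  obtain x s where l: "l = (x, s)" by (cases l)
  let ?i = "rev (map (\<lambda>(x, s). (x, \<not> s)) u)"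
  have "pres_eq R [(x, \<not> s), (x, s)] []"
    using pres_cancel[of R x "\<not> s"] by simp
  then have "pres_eq R (?i @ ([(x, \<not> s), (x, s)] @ u)) (?i @ ([] @ u))"
    by (intro pres_append pres_refl)
  then have "pres_eq R (?i @ ([(x, \<not> s), (x, s)] @ u)) []"
    using Cons.IH by (auto intro: pres_trans)
  then show ?case by (simp add: l)
qed

lemma group_presented_group: "group (presented_group R)"
proof (rule groupI)
  fix X assume "X \<in> carrier (presented_group R)"
  then obtain u where "X = word_class R u" by (auto simp: presented_group_carrier)
  then show "\<exists>Y\<in>carrier (presented_group R).
      Y \<otimes>\<^bsub>presented_group R\<^esub> X = \<one>\<^bsub>presented_group R\<^esub>"
    by (auto simp: presented_group_carrier presented_group_one presented_group_mult
        word_class_eq_iff intro!: pres_left_inverse)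
qed (auto simp: presented_group_carrier presented_group_one presented_group_mult)


section \<open>The semidihedral group of order $8n$\<close>

datatype sd_gen = Gen_a | Gen_b

definition sd_relators :: "nat \<Rightarrow> (sd_gen word \<times> sd_gen word) set" where
  "sd_relators n =
    (let a = (Gen_a, True); b = (Gen_b, True) in
      {(replicate (4 * n) a, []),
       (replicate 2 b, []),
       ([b, a], replicate (2 * n - 1) a @ [b])})"

definition semidihedral :: "nat \<Rightarrow> sd_gen word set monoid" where
  "semidihedral n = presented_group (sd_relators n)"

lemma sd_relations:
  "pres_eq (sd_relators n) (replicate (4 * n) (Gen_a, True)) []"
  "pres_eq (sd_relators n) (replicate 2 (Gen_b, True)) []"
  "pres_eq (sd_relators n) [(Gen_b, True), (Gen_a, True)]
     (replicate (2 * n - 1) (Gen_a, True) @ [(Gen_b, True)])"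
  by (rule pres_rel, simp add: sd_relators_def Let_def)+

lemma group_semidihedral: "group (semidihedral n)"
  by (simp add: semidihedral_def group_presented_group)

text \<open>
  The lower bound in \<open>order (semidihedral n) = 8 * n\<close> comes from letting words
  act on \<open>{0..<4 * n} \<times> UNIV\<close>, the pair \<open>(i, j)\<close> standing for \<open>a^i b^j\<close>.
\<close>

fun sd_step :: "nat \<Rightarrow> sd_gen \<times> bool \<Rightarrow> int \<times> bool \<Rightarrow> int \<times> bool" where
  "sd_step n (Gen_a, s) (i, j) = ((i + (if s then 1 else -1)) mod (4 * int n), j)"
| "sd_step n (Gen_b, s) (i, j) = (((2 * int n - 1) * i) mod (4 * int n), \<not> j)"

definition sd_act :: "nat \<Rightarrow> sd_gen word \<Rightarrow> int \<times> bool \<Rightarrow> int \<times> bool" where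
  "sd_act n w = foldr (sd_step n) w"

abbreviation sd_dom :: "nat \<Rightarrow> (int \<times> bool) set" where
  "sd_dom n \<equiv> {0..<4 * int n} \<times> UNIV"

lemma sd_act_simps [simp]:
  "sd_act n [] p = p"
  "sd_act n (l # w) p = sd_step n l (sd_act n w p)"
  "sd_act n (u @ v) p = sd_act n u (sd_act n v p)"
  by (simp_all add: sd_act_def)

lemma sd_step_dom: "n > 0 \<Longrightarrow> p \<in> sd_dom n \<Longrightarrow> sd_step n l p \<in> sd_dom n"
  by (cases p; cases l; cases "fst l") auto

lemma sd_act_dom: "n > 0 \<Longrightarrow> p \<in> sd_dom n \<Longrightarrow> sd_act n w p \<in> sd_dom n"
  by (induction w) (simp_all only: sd_act_simps sd_step_dom)

lemma sd_act_power_a: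
  "sd_act n (replicate k (Gen_a, True)) (i mod (4 * int n), j) = ((i + int k) mod (4 * int n), j)"
  by (induction k) (simp_all add: mod_simps algebra_simps)

lemma sd_square_mod: "((2 * int n - 1) * ((2 * int n - 1) * i)) mod (4 * int n) = i mod (4 * int n)"
proof -
  have "(2 * int n - 1) * ((2 * int n - 1) * i) = i + (4 * int n) * ((int n - 1) * i)"
    by (simp add: algebra_simps)
  then show ?thesis by simp
qed

lemma sd_act_eq:
  assumes "pres_eq (sd_relators n) u v" "n > 0" "p \<in> sd_dom n"
  shows "sd_act n u p = sd_act n v p"
  using assms(1,3)
proof (induction arbitrary: p rule: pres_eq.induct)
  case (pres_rel u v)
  obtain i j where p: "p = (i mod (4 * int n), j)" "i mod (4 * int n) = i"
    using pres_rel.prems by (cases p) auto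
  have b: "sd_act n (replicate 2 (Gen_b, True)) p = p"
    by (simp add: p(1) numeral_2_eq_2 mod_simps sd_square_mod)
  have a: "sd_act n (replicate (4 * n) (Gen_a, True)) p = p"
    unfolding p(1) sd_act_power_a by simp
  have "sd_act n ([(Gen_b, True), (Gen_a, True)]) p =
      (((2 * int n - 1) * (i + 1)) mod (4 * int n), \<not> j)"
    by (simp add: p(1) mod_simps)
  also have "\<dots> = sd_act n (replicate (2 * n - 1) (Gen_a, True) @ [(Gen_b, True)]) p"
  proof -
    have "sd_act n [(Gen_b, True)] p = (((2 * int n - 1) * i) mod (4 * int n), \<not> j)"
      by (simp add: p)
    moreover have "(2 * int n - 1) * (i + 1) = (2 * int n - 1) * i + int (2 * n - 1)"
      using \<open>n > 0\<close> by (simp add: of_nat_diff algebra_simps)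
    ultimately show ?thesis
      by (simp only: sd_act_simps(3) sd_act_power_a)
  qed
  finally show ?case
    using a b pres_rel.hyps by (auto simp: sd_relators_def Let_def simp del: sd_act_simps(2,3))
next
  case (pres_cancel x s)
  obtain i j where "p = (i, j)" "i mod (4 * int n) = i"
    using pres_cancel by (cases p) auto
  then show ?case by (cases x) (auto simp: mod_simps sd_square_mod)
next
  case (pres_append u u' v v')
  then show ?case using sd_act_dom[OF \<open>n > 0\<close>] by simp
next
  case (pres_sym u v)
  then show ?case by simp
next
  case (pres_trans u v w)
  then show ?case by simp
qed simp

definition sd_normal :: "nat \<Rightarrow> nat \<Rightarrow> sd_gen word" where
  "sd_normal i j = replicate i (Gen_a, True) @ replicate j (Gen_b, True)"

lemma sd_a_reduce:
  assumes "n > 0"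
  shows "pres_eq (sd_relators n) (replicate i (Gen_a, True)) (replicate (i mod (4 * n)) (Gen_a, True))"
proof (induction i rule: less_induct)
  case (less i)
  show ?case
  proof (cases "i < 4 * n")
    case True
    then show ?thesis by (simp add: pres_refl)
  next
    case False
    then have "pres_eq (sd_relators n) (replicate (4 * n) (Gen_a, True) @ replicate (i - 4 * n) (Gen_a, True))
        ([] @ replicate (i - 4 * n) (Gen_a, True))"
      by (intro pres_append pres_refl sd_relations)
    then have "pres_eq (sd_relators n) (replicate i (Gen_a, True)) (replicate (i - 4 * n) (Gen_a, True))"
      using False by (simp flip: replicate_add)
    moreover have "(i - 4 * n) mod (4 * n) = i mod (4 * n)"
      using False by (simp add: mod_if)
    ultimately show ?thesis
      using less.IH[of "i - 4 * n"] False assms by (auto intro: pres_trans)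
  qed
qed

lemma sd_b_reduce:
  "pres_eq (sd_relators n) (replicate j (Gen_b, True)) (replicate (j mod 2) (Gen_b, True))"
proof (induction j rule: less_induct)
  case (less j)
  show ?case
  proof (cases "j < 2")
    case True
    then show ?thesis by (simp add: pres_refl)
  next
    case False
    then have "pres_eq (sd_relators n) (replicate 2 (Gen_b, True) @ replicate (j - 2) (Gen_b, True))
        ([] @ replicate (j - 2) (Gen_b, True))"
      by (intro pres_append pres_refl sd_relations)
    moreover have "replicate 2 (Gen_b, True) @ replicate (j - 2) (Gen_b, True) = replicate j (Gen_b, True)"
      using False by (metis le_add_diff_inverse not_less replicate_add)
    ultimately have "pres_eq (sd_relators n) (replicate j (Gen_b, True)) (replicate (j - 2) (Gen_b, True))"
      by simp
    moreover have "(j - 2) mod 2 = j mod 2"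
      using False by (simp add: mod_if)
    ultimately show ?thesis
      using less.IH[of "j - 2"] False by (auto intro: pres_trans)
  qed
qed

lemma sd_swap:
  "pres_eq (sd_relators n) ((Gen_b, True) # replicate i (Gen_a, True))
    (replicate ((2 * n - 1) * i) (Gen_a, True) @ [(Gen_b, True)])"
proof (induction i)
  case 0
  show ?case by (simp add: pres_refl)
next
  case (Suc i)
  let ?a = "(Gen_a, True)" and ?b = "(Gen_b, True)"
  have "pres_eq (sd_relators n) ([?b, ?a] @ replicate i ?a)
      ((replicate (2 * n - 1) ?a @ [?b]) @ replicate i ?a)"
    by (intro pres_append pres_refl sd_relations)
  moreover have "pres_eq (sd_relators n) (replicate (2 * n - 1) ?a @ (?b # replicate i ?a))
     (replicate (2 * n - 1) ?a @ (replicate ((2 * n - 1) * i) ?a @ [?b]))"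
    by (intro pres_append pres_refl Suc.IH)
  ultimately have "pres_eq (sd_relators n) (?b # replicate (Suc i) ?a)
     (replicate (2 * n - 1) ?a @ (replicate ((2 * n - 1) * i) ?a @ [?b]))"
    by (auto intro: pres_trans)
  then show ?case by (simp add: replicate_add)
qed

lemma sd_inverse_letters:
  assumes "n > 0"
  shows "pres_eq (sd_relators n) [(Gen_a, False)] (replicate (4 * n - 1) (Gen_a, True))"
    and "pres_eq (sd_relators n) [(Gen_b, False)] [(Gen_b, True)]"
proof -
  have *: "pres_eq R [(x, False)] (replicate (k - 1) (x, True))"
    if "pres_eq R (replicate k (x, True)) []" "k > 0" for R x and k :: nat
  proof -
    have "pres_eq R ([(x, False)] @ []) ([(x, False)] @ replicate k (x, True))"
      using that by (intro pres_append pres_refl) (rule pres_sym)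
    moreover have "[(x, False)] @ replicate k (x, True) = [(x, False), (x, True)] @ replicate (k - 1) (x, True)"
      using that(2) by (cases k) auto
    moreover have "pres_eq R ([(x, False), (x, True)] @ replicate (k - 1) (x, True)) ([] @ replicate (k - 1) (x, True))"
      using pres_cancel[of R x False] by (intro pres_append pres_refl) simp
    ultimately show ?thesis by (auto intro: pres_trans)
  qed
  show "pres_eq (sd_relators n) [(Gen_a, False)] (replicate (4 * n - 1) (Gen_a, True))"
    by (rule *) (use assms sd_relations(1) in auto)
  show "pres_eq (sd_relators n) [(Gen_b, False)] [(Gen_b, True)]"
    using *[OF sd_relations(2)] by simp
qed

lemma sd_normal_form:
  assumes "n > 0"
  shows "\<exists>i<4 * n. \<exists>j<2. pres_eq (sd_relators n) w (sd_normal i j)"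
proof -
  let ?R = "sd_relators n" and ?a = "(Gen_a, True)" and ?b = "(Gen_b, True)"
  have "\<exists>i j. pres_eq ?R w (sd_normal i j)"
  proof (induction w)
    case Nil
    have "pres_eq ?R [] (sd_normal 0 0)" by (simp add: sd_normal_def pres_refl)
    then show ?case by blast
  next
    case (Cons l w)
    then obtain i j where ij: "pres_eq ?R w (sd_normal i j)" by blast
    have step: "pres_eq ?R (l # w) (v @ sd_normal i j)" if "pres_eq ?R [l] v" for v
      using pres_append[OF that ij] by simp
    obtain x s where l: "l = (x, s)" by (cases l)
    show ?case
    proof (cases x)
      case Gen_a
      have "\<exists>k. pres_eq ?R [l] (replicate k ?a)"
      proof (cases s)
        case True
        then have "pres_eq ?R [l] (replicate 1 ?a)" by (simp add: l Gen_a pres_refl)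
        then show ?thesis by blast
      next
        case False
        then show ?thesis using sd_inverse_letters(1)[OF assms] by (auto simp: l Gen_a)
      qed
      then obtain k where "pres_eq ?R [l] (replicate k ?a)" by blast
      from step[OF this] have "pres_eq ?R (l # w) (sd_normal (k + i) j)"
        by (simp add: sd_normal_def replicate_add)
      then show ?thesis by blast
    next
      case Gen_b
      have "pres_eq ?R [l] [?b]"
        using sd_inverse_letters(2)[OF assms] by (cases s) (auto simp: l Gen_b pres_refl)
      from step[OF this] have "pres_eq ?R (l # w) ((?b # replicate i ?a) @ replicate j ?b)"
        by (simp add: sd_normal_def)
      moreover have "pres_eq ?R ((?b # replicate i ?a) @ replicate j ?b)
          ((replicate ((2 * n - 1) * i) ?a @ [?b]) @ replicate j ?b)"
        by (intro pres_append pres_refl sd_swap)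
      ultimately have "pres_eq ?R (l # w) (sd_normal ((2 * n - 1) * i) (Suc j))"
        by (auto simp: sd_normal_def intro: pres_trans)
      then show ?thesis by blast
    qed
  qed
  then obtain i j where "pres_eq ?R w (sd_normal i j)" by blast
  moreover have "pres_eq ?R (sd_normal i j) (sd_normal (i mod (4 * n)) (j mod 2))"
    unfolding sd_normal_def by (intro pres_append sd_a_reduce sd_b_reduce assms)
  ultimately show ?thesis
    using assms by (meson mod_less_divisor mult_pos_pos pos2 pres_trans zero_less_numeral)
qed

theorem order_semidihedral:
  assumes "n > 0"
  shows "order (semidihedral n) = 8 * n"
proof -
  let ?R = "sd_relators n"
  let ?f = "\<lambda>(i, j). word_class ?R (sd_normal i j)"
  have act: "sd_act n (sd_normal i j) (0, False) = (int i, j = 1)" if "i < 4 * n" "j < 2" for i j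
  proof -
    have "sd_act n (replicate j (Gen_b, True)) (0, False) = (0 mod (4 * int n), j = 1)"
      using that(2) by (auto simp: less_2_cases_iff)
    then show ?thesis
      using that(1) by (simp only: sd_normal_def sd_act_simps sd_act_power_a) simp
  qed
  have "inj_on ?f ({..<4 * n} \<times> {..<2})"
  proof (rule inj_onI, clarsimp simp: word_class_eq_iff)
    fix i j i' j' :: nat
    assume *: "i < 4 * n" "j < 2" "i' < 4 * n" "j' < 2"
      and "pres_eq ?R (sd_normal i j) (sd_normal i' j')"
    then have "sd_act n (sd_normal i j) (0, False) = sd_act n (sd_normal i' j') (0, False)"
      using assms by (intro sd_act_eq) auto
    then show "i = i' \<and> j = j'"
      using * by (auto simp: act less_2_cases_iff)
  qed
  moreover have "?f ` ({..<4 * n} \<times> {..<2}) = carrier (semidihedral n)"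
  proof (rule subset_antisym)
    show "carrier (semidihedral n) \<subseteq> ?f ` ({..<4 * n} \<times> {..<2})"
    proof
      fix X assume "X \<in> carrier (semidihedral n)"
      then obtain w where w: "X = word_class ?R w"
        by (auto simp: semidihedral_def presented_group_carrier)
      obtain i j where "i < 4 * n" "j < 2" "pres_eq ?R w (sd_normal i j)"
        using sd_normal_form[OF assms] by blast
      then show "X \<in> ?f ` ({..<4 * n} \<times> {..<2})"
        by (intro image_eqI[of _ _ "(i, j)"]) (auto simp: w word_class_eq_iff)
    qed
  qed (auto simp: semidihedral_def presented_group_carrier)
  ultimately have "card (carrier (semidihedral n)) = card ({..<4 * n} \<times> {..<2::nat})"
    by (metis card_image)
  then show ?thesis by (simp add: order_def)
qed


section \<open>Commuting graphs and perfect graphs\<close>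

text \<open>Following the AFP entry Graph Theory, simple graphs are symmetric loop-free digraphs.\<close>

definition commuting_graph :: "('a, 'm) monoid_scheme \<Rightarrow> 'a pair_pre_digraph" where
  "commuting_graph G =
    \<lparr> pverts = carrier G,
      parcs = {(x, y). x \<in> carrier G \<and> y \<in> carrier G \<and> x \<noteq> y \<and>
                 x \<otimes>\<^bsub>G\<^esub> y = y \<otimes>\<^bsub>G\<^esub> x} \<rparr>"

lemma commuting_graph_bidirected: "pair_bidirected_digraph (commuting_graph G)"
  by unfold_locales (auto simp: commuting_graph_def symmetric_def sym_def)

definition is_clique :: "('a, 'b) pre_digraph \<Rightarrow> 'a set \<Rightarrow> bool" where
  "is_clique \<Gamma> K \<longleftrightarrow> K \<subseteq> verts \<Gamma> \<and> (\<forall>u\<in>K. \<forall>v\<in>K. u \<noteq> v \<longrightarrow> u \<rightarrow>\<^bsub>\<Gamma>\<^esub> v)"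

definition is_coloring :: "('a, 'b) pre_digraph \<Rightarrow> nat \<Rightarrow> ('a \<Rightarrow> nat) \<Rightarrow> bool" where
  "is_coloring \<Gamma> k c \<longleftrightarrow>
    (\<forall>v\<in>verts \<Gamma>. c v < k) \<and> (\<forall>u\<in>verts \<Gamma>. \<forall>v\<in>verts \<Gamma>. u \<rightarrow>\<^bsub>\<Gamma>\<^esub> v \<longrightarrow> c u \<noteq> c v)"

text \<open>
  Both invariants take values in \<^typ>\<open>enat\<close>, so that they are \<open>\<infinity>\<close> rather than arbitrary when
  there is no largest finite clique or no finite coloring. Both are 0 for the null graph.
\<close>

definition clique_number :: "('a, 'b) pre_digraph \<Rightarrow> enat" where
  "clique_number \<Gamma> = Sup {enat (card K) | K. finite K \<and> is_clique \<Gamma> K}"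

definition chromatic_number :: "('a, 'b) pre_digraph \<Rightarrow> enat" where
  "chromatic_number \<Gamma> = Inf {enat k | k. \<exists>c. is_coloring \<Gamma> k c}"

definition perfect_graph :: "('a, 'b) pre_digraph \<Rightarrow> bool" where
  "perfect_graph \<Gamma> \<longleftrightarrow>
    (\<forall>\<Gamma>'. induced_subgraph \<Gamma>' \<Gamma> \<longrightarrow> clique_number \<Gamma>' = chromatic_number \<Gamma>')"

end

theory Submission
  imports Defs "HOL-Algebra.Generated_Groups"
begin

text \<open>
  The rotation subgroup \<open>\<langle>a\<rangle>\<close> is abelian of index 2. In a group with such a subgroup every
  non-central element has an abelian centralizer, so after listing the central elements first, the
  earlier neighbours of each vertex form a clique and adjacency is transitive along increasing
  sequences. Both properties pass to induced subgraphs, and the number of earlier neighbours of a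
  vertex is then a proper coloring that needs no more colors than the largest clique has vertices.
\<close>

section \<open>Trivially perfect orderings\<close>

text \<open>A coloring is injective on every clique.\<close>

lemma clique_number_le_chromatic_number: "clique_number \<Gamma> \<le> chromatic_number \<Gamma>"
proof -
  have "card K \<le> k" if "is_clique \<Gamma> K" "is_coloring \<Gamma> k c" for K k c
  proof -
    have "inj_on c K"
      using that unfolding inj_on_def is_clique_def is_coloring_def by blast
    moreover have "c ` K \<subseteq> {..<k}"
      using that unfolding is_clique_def is_coloring_def by blast
    ultimately show ?thesis
      using card_inj_on_le[of c K "{..<k}"] by simp
  qed
  then show ?thesis
    unfolding clique_number_def chromatic_number_def
    by (auto intro!: Sup_least Inf_greatest)
qed

text \<open>\<open>trans\<close> makes the number of earlier neighbours strictly increase along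
  every edge, so it is a proper coloring. \<open>chain\<close> makes a vertex together with its
  earlier neighbours a clique, so this coloring uses no more colors than the clique number.\<close>

lemma clique_number_eq_chromatic_number_if_ordering:
  fixes f :: "'a \<Rightarrow> nat"
  assumes fin: "finite (verts \<Gamma>)"
    and sym: "\<And>u v. u \<rightarrow>\<^bsub>\<Gamma>\<^esub> v \<Longrightarrow> v \<rightarrow>\<^bsub>\<Gamma>\<^esub> u"
    and neq: "\<And>u v. u \<rightarrow>\<^bsub>\<Gamma>\<^esub> v \<Longrightarrow> f u \<noteq> f v"
    and trans: "\<And>u v w. u \<rightarrow>\<^bsub>\<Gamma>\<^esub> v \<Longrightarrow> v \<rightarrow>\<^bsub>\<Gamma>\<^esub> w \<Longrightarrow> f u < f v \<Longrightarrow> f v < f w \<Longrightarrow> u \<rightarrow>\<^bsub>\<Gamma>\<^esub> w"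
    and chain: "\<And>u v w. u \<rightarrow>\<^bsub>\<Gamma>\<^esub> v \<Longrightarrow> w \<rightarrow>\<^bsub>\<Gamma>\<^esub> v \<Longrightarrow> f u < f v \<Longrightarrow> f w < f v \<Longrightarrow> u \<noteq> w \<Longrightarrow> u \<rightarrow>\<^bsub>\<Gamma>\<^esub> w"
  shows "clique_number \<Gamma> = chromatic_number \<Gamma>"
proof (rule antisym[OF clique_number_le_chromatic_number])
  define P where "P v = {u \<in> verts \<Gamma>. u \<rightarrow>\<^bsub>\<Gamma>\<^esub> v \<and> f u < f v}" for v
  \<comment> \<open>\<open>Suc\<close> because the colors start at 0. The inserted 0 gives
    \<open>k = 0\<close> for the null graph, where no vertex attains the maximum.\<close>
  define k where "k = Max (insert 0 ((\<lambda>v. Suc (card (P v))) ` verts \<Gamma>))"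
  have finP: "finite (P v)" for v
    using fin by (simp add: P_def)
  have less: "card (P u) < card (P v)" if "u \<in> verts \<Gamma>" "u \<rightarrow>\<^bsub>\<Gamma>\<^esub> v" "f u < f v" for u v
  proof (rule psubset_card_mono[OF finP])
    \<comment> \<open>The inclusion is \<open>trans\<close>; it is strict because of
      \<open>u\<close> itself.\<close>
    have "u \<in> P v" "u \<notin> P u" "P u \<subseteq> P v"
      using that trans by (auto simp: P_def)
    then show "P u \<subset> P v" by blast
  qed
  have "is_coloring \<Gamma> k (\<lambda>v. card (P v))"
    unfolding is_coloring_def
  proof (intro conjI ballI impI)
    fix v assume "v \<in> verts \<Gamma>"
    then have "Suc (card (P v)) \<le> k"
      unfolding k_def using fin by (intro Max_ge) auto
    then show "card (P v) < k" by simp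
  next
    fix u v assume "u \<in> verts \<Gamma>" "v \<in> verts \<Gamma>" "u \<rightarrow>\<^bsub>\<Gamma>\<^esub> v"
    then show "card (P u) \<noteq> card (P v)"
      using less[of u v] less[of v u] sym neq[of u v] by (metis nat_neq_iff)
  qed
  then have "chromatic_number \<Gamma> \<le> enat k"
    unfolding chromatic_number_def by (auto intro: Inf_lower)
  also have "enat k \<le> clique_number \<Gamma>"
  proof -
    have "k \<in> insert 0 ((\<lambda>v. Suc (card (P v))) ` verts \<Gamma>)"
      unfolding k_def using fin by (intro Max_in) auto
    then consider "k = 0" | v where "v \<in> verts \<Gamma>" "k = Suc (card (P v))"
      by auto
    then show ?thesis
    proof cases
      case 1
      then show ?thesis by (simp flip: zero_enat_def)
    next
      case 2
      \<comment> \<open>A vertex attaining the maximum yields a clique of size exactly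
        \<open>k\<close>: two earlier neighbours are adjacent by \<open>chain\<close>, and
        \<open>v\<close> is not in \<open>P v\<close>.\<close>
      have "is_clique \<Gamma> (insert v (P v))"
        unfolding is_clique_def
      proof (intro conjI ballI impI)
        show "insert v (P v) \<subseteq> verts \<Gamma>"
          using 2(1) by (auto simp: P_def)
      next
        fix u w assume "u \<in> insert v (P v)" "w \<in> insert v (P v)" "u \<noteq> w"
        then consider "u = v" "w \<in> P v" | "w = v" "u \<in> P v" | "u \<in> P v" "w \<in> P v"
          by blast
        then show "u \<rightarrow>\<^bsub>\<Gamma>\<^esub> w"
          using sym chain[of u v w] \<open>u \<noteq> w\<close> by cases (simp_all add: P_def)
      qed
      moreover have "card (insert v (P v)) = k"
        using finP 2(2) by (simp add: P_def)
      ultimately show ?thesis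
        unfolding clique_number_def using finP by (intro Sup_upper) blast
    qed
  qed
  finally show "chromatic_number \<Gamma> \<le> clique_number \<Gamma>" .
qed

lemma induced_subgraph_dominates_iff:
  assumes "induced_subgraph H G"
  shows "u \<rightarrow>\<^bsub>H\<^esub> v \<longleftrightarrow> u \<in> verts H \<and> v \<in> verts H \<and> u \<rightarrow>\<^bsub>G\<^esub> v"
proof -
  have "tail H = tail G" "head H = head G"
    "arcs H = {e \<in> arcs G. tail G e \<in> verts H \<and> head G e \<in> verts H}"
    using assms by (auto simp: induced_subgraph_def subgraph_def compatible_def)
  then show ?thesis
    by (auto simp: arcs_ends_def arc_to_ends_def)
qed

text \<open>All conditions on \<open>f\<close> are universal and conclude adjacency only between
  vertices already present, so the same \<open>f\<close> serves every induced subgraph.\<close>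

lemma perfect_graph_if_ordering:
  fixes f :: "'a \<Rightarrow> nat"
  assumes "finite (verts \<Gamma>)"
    and "\<And>u v. u \<rightarrow>\<^bsub>\<Gamma>\<^esub> v \<Longrightarrow> v \<rightarrow>\<^bsub>\<Gamma>\<^esub> u"
    and "\<And>u v. u \<rightarrow>\<^bsub>\<Gamma>\<^esub> v \<Longrightarrow> f u \<noteq> f v"
    and "\<And>u v w. u \<rightarrow>\<^bsub>\<Gamma>\<^esub> v \<Longrightarrow> v \<rightarrow>\<^bsub>\<Gamma>\<^esub> w \<Longrightarrow> f u < f v \<Longrightarrow> f v < f w \<Longrightarrow> u \<rightarrow>\<^bsub>\<Gamma>\<^esub> w"
    and "\<And>u v w. u \<rightarrow>\<^bsub>\<Gamma>\<^esub> v \<Longrightarrow> w \<rightarrow>\<^bsub>\<Gamma>\<^esub> v \<Longrightarrow> f u < f v \<Longrightarrow> f w < f v \<Longrightarrow> u \<noteq> w \<Longrightarrow> u \<rightarrow>\<^bsub>\<Gamma>\<^esub> w"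
  shows "perfect_graph \<Gamma>"
  unfolding perfect_graph_def
proof (intro allI impI)
  fix H assume H: "induced_subgraph H \<Gamma>"
  then have "verts H \<subseteq> verts \<Gamma>"
    by (auto simp: induced_subgraph_def subgraph_def)
  then have "finite (verts H)"
    using assms(1) finite_subset by blast
  then show "clique_number H = chromatic_number H"
    by (rule clique_number_eq_chromatic_number_if_ordering[where f = f])
      (unfold induced_subgraph_dominates_iff[OF H], (use assms(2-5) in blast)+)
qed


section \<open>Groups with an abelian subgroup of index 2\<close>

lemma commuting_graph_dominates_iff:
  "x \<rightarrow>\<^bsub>with_proj (commuting_graph G)\<^esub> y \<longleftrightarrow>
    x \<in> carrier G \<and> y \<in> carrier G \<and> x \<noteq> y \<and> x \<otimes>\<^bsub>G\<^esub> y = y \<otimes>\<^bsub>G\<^esub> x"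
  by (auto simp: arcs_ends_def arc_to_ends_def commuting_graph_def)

text \<open>The assumption \<open>central\<close> is the contrapositive of: the centralizer of a
  non-central element is abelian. The ordering required above lists the center first and is
  otherwise arbitrary.\<close>

lemma perfect_commuting_graph_if_centralizers_commute:
  fixes G (structure)
  assumes fin: "finite (carrier G)"
    and central: "\<And>x y z. x \<in> carrier G \<Longrightarrow> y \<in> carrier G \<Longrightarrow> z \<in> carrier G \<Longrightarrow>
      x \<otimes> y = y \<otimes> x \<Longrightarrow> x \<otimes> z = z \<otimes> x \<Longrightarrow> y \<otimes> z \<noteq> z \<otimes> y \<Longrightarrow> \<forall>w\<in>carrier G. x \<otimes> w = w \<otimes> x"
  shows "perfect_graph (with_proj (commuting_graph G))"
proof -
  obtain g :: "'a \<Rightarrow> nat" where g: "inj_on g (carrier G)"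
    using finite_imp_inj_to_nat_seg[OF fin] by blast
  define Z where "Z = {x \<in> carrier G. \<forall>w\<in>carrier G. x \<otimes> w = w \<otimes> x}"
  \<comment> \<open>\<open>N\<close> exceeds every value of \<open>g\<close>, so adding it moves the
    non-central elements behind all central ones. The inserted 0 keeps \<open>Max\<close> defined on
    an empty carrier.\<close>
  define N where "N = Suc (Max (insert 0 (g ` carrier G)))"
  have N: "g x < N" if "x \<in> carrier G" for x
    unfolding N_def using fin that by (auto simp: less_Suc_eq_le)
  define f where "f x = (if x \<in> Z then g x else g x + N)" for x
  have neq: "f x \<noteq> f y" if "x \<in> carrier G" "y \<in> carrier G" "x \<noteq> y" for x y
    using N[OF that(1)] N[OF that(2)] inj_onD[OF g _ that(1,2)] that(3)
    by (auto simp: f_def)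
  have mono: "x \<in> Z" if "f x < f y" "y \<in> Z" for x y
    using that N[of y] by (auto simp: f_def Z_def split: if_splits)
  have Z: "x \<otimes> w = w \<otimes> x" if "x \<in> Z" "w \<in> carrier G" for x w
    using that by (auto simp: Z_def)
  \<comment> \<open>Otherwise \<open>x\<close> is central by \<open>central\<close>, hence so is the
    earlier \<open>y\<close>, which then commutes with \<open>z\<close>. Both ordering conditions
    are instances, with the middle or last vertex as \<open>x\<close>.\<close>
  have comm: "y \<otimes> z = z \<otimes> y"
    if "x \<in> carrier G" "y \<in> carrier G" "z \<in> carrier G"
      "x \<otimes> y = y \<otimes> x" "x \<otimes> z = z \<otimes> x" "f y < f x" for x y z
    using central[OF that(1-5)] Z[OF mono[OF that(6)] that(3)] that(1) by (auto simp: Z_def)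
  show ?thesis
  proof (rule perfect_graph_if_ordering[where f = f], unfold commuting_graph_dominates_iff)
    show "finite (verts (with_proj (commuting_graph G)))"
      using fin by (simp add: commuting_graph_def)
  next
    fix u v w
    assume uv: "u \<in> carrier G \<and> v \<in> carrier G \<and> u \<noteq> v \<and> u \<otimes> v = v \<otimes> u"
      and vw: "v \<in> carrier G \<and> w \<in> carrier G \<and> v \<noteq> w \<and> v \<otimes> w = w \<otimes> v"
      and "f u < f v" "f v < f w"
    then show "u \<in> carrier G \<and> w \<in> carrier G \<and> u \<noteq> w \<and> u \<otimes> w = w \<otimes> u"
      using comm[of v u w] by auto
  next
    fix u v w
    assume uv: "u \<in> carrier G \<and> v \<in> carrier G \<and> u \<noteq> v \<and> u \<otimes> v = v \<otimes> u"
      and vw: "w \<in> carrier G \<and> v \<in> carrier G \<and> w \<noteq> v \<and> w \<otimes> v = v \<otimes> w"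
      and "f u < f v" "f w < f v" "u \<noteq> w"
    then show "u \<in> carrier G \<and> w \<in> carrier G \<and> u \<noteq> w \<and> u \<otimes> w = w \<otimes> u"
      using comm[of v u w] by auto
  qed (use neq in auto)
qed

lemma (in group) commute_mult:
  assumes "x \<in> carrier G" "y \<in> carrier G" "z \<in> carrier G" "x \<otimes> y = y \<otimes> x" "x \<otimes> z = z \<otimes> x"
  shows "x \<otimes> (y \<otimes> z) = (y \<otimes> z) \<otimes> x"
proof -
  have "x \<otimes> (y \<otimes> z) = (y \<otimes> x) \<otimes> z"
    using assms by (simp flip: m_assoc)
  also have "\<dots> = (y \<otimes> z) \<otimes> x"
    using assms by (simp add: m_assoc)
  finally show ?thesis .
qed

lemma (in group) commute_inv:
  assumes "x \<in> carrier G" "y \<in> carrier G" "x \<otimes> y = y \<otimes> x"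
  shows "x \<otimes> inv y = inv y \<otimes> x"
proof -
  have "y \<otimes> (x \<otimes> inv y) = x"
    using assms by (simp add: inv_solve_right' flip: m_assoc)
  then show ?thesis
    using assms by (simp add: inv_solve_left)
qed

text \<open>The condition \<open>index\<close> puts all elements outside \<open>A\<close> into one
  right coset, which avoids counting cosets. Any \<open>v\<close> outside \<open>A\<close> therefore
  generates the group together with \<open>A\<close>.\<close>

lemma (in group) perfect_commuting_graph_if_abelian_index_2:
  assumes fin: "finite (carrier G)" and A: "subgroup A G"
    and abelian: "\<And>x y. x \<in> A \<Longrightarrow> y \<in> A \<Longrightarrow> x \<otimes> y = y \<otimes> x"
    and index: "\<And>x y. x \<in> carrier G - A \<Longrightarrow> y \<in> carrier G - A \<Longrightarrow> x \<otimes> inv y \<in> A"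
  shows "perfect_graph (with_proj (commuting_graph G))"
proof (rule perfect_commuting_graph_if_centralizers_commute[OF fin])
  fix x y z
  assume carr: "x \<in> carrier G" "y \<in> carrier G" "z \<in> carrier G"
    and xy: "x \<otimes> y = y \<otimes> x" and xz: "x \<otimes> z = z \<otimes> x" and yz: "y \<otimes> z \<noteq> z \<otimes> y"
  note AG = subgroup.mem_carrier[OF A]
  have cancel: "(v \<otimes> inv w) \<otimes> w = v" if "v \<in> carrier G" "w \<in> carrier G" for v w
    using that by (simp add: m_assoc)
  \<comment> \<open>An element of \<open>A\<close> that commutes with some \<open>v\<close> outside
    \<open>A\<close> is central: any \<open>w\<close> outside \<open>A\<close> is the product of
    \<open>w \<otimes> inv v\<close>, which lies in \<open>A\<close>, and \<open>v\<close>.\<close>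
  have central: "u \<otimes> w = w \<otimes> u"
    if "u \<in> A" "v \<in> carrier G - A" "u \<otimes> v = v \<otimes> u" "w \<in> carrier G" for u v w
  proof (cases "w \<in> A")
    case False
    then have "w \<otimes> inv v \<in> A"
      using index that by blast
    then have "u \<otimes> ((w \<otimes> inv v) \<otimes> v) = ((w \<otimes> inv v) \<otimes> v) \<otimes> u"
      using that abelian[of u "w \<otimes> inv v"] AG[of u] by (intro commute_mult[of u "w \<otimes> inv v" v]) simp_all
    then show ?thesis
      using cancel[of w v] that by simp
  qed (use abelian[of u w] that in blast)
  have "x \<in> A"
  proof (rule ccontr)
    assume "x \<notin> A"
    then have x: "x \<in> carrier G - A"
      using carr by blast
    \<comment> \<open>The centralizer of \<open>x\<close> consists of central elements and their products with \<open>x\<close>.\<close>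
    have "v \<otimes> w = w \<otimes> v"
      if v: "v \<in> carrier G" "x \<otimes> v = v \<otimes> x" and w: "w \<in> carrier G" "x \<otimes> w = w \<otimes> x" for v w
    proof (cases "v \<in> A")
      case True
      then show ?thesis
        using central[of v x w] x v w by simp
    next
      case False
      \<comment> \<open>The factor \<open>v \<otimes> inv x\<close> lies in \<open>A\<close> and
        commutes with \<open>x\<close>, so it is central; multiplying it by \<open>x\<close>
        recovers \<open>v\<close>.\<close>
      have c: "v \<otimes> inv x \<in> carrier G" "v \<otimes> inv x \<in> A"
        using index[of v x] False v x by simp_all
      moreover have "x \<otimes> (v \<otimes> inv x) = (v \<otimes> inv x) \<otimes> x"
        using x v commute_inv[of x x] by (intro commute_mult[of x v "inv x"]) simp_all
      ultimately have "(v \<otimes> inv x) \<otimes> w = w \<otimes> (v \<otimes> inv x)"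
        using central[of "v \<otimes> inv x" x w] x w by simp
      then have "w \<otimes> ((v \<otimes> inv x) \<otimes> x) = ((v \<otimes> inv x) \<otimes> x) \<otimes> w"
        using w x c by (intro commute_mult[of w "v \<otimes> inv x" x]) simp_all
      then show ?thesis
        using cancel[of v x] v x by simp
    qed
    then show False
      using yz carr xy xz by blast
  qed
  \<comment> \<open>Whichever of \<open>y\<close> and \<open>z\<close> lies outside \<open>A\<close>
    commutes with \<open>x\<close> in \<open>A\<close>, which makes \<open>x\<close>
    central.\<close>
  moreover have "y \<notin> A \<or> z \<notin> A"
    using abelian yz by blast
  ultimately show "\<forall>w\<in>carrier G. x \<otimes> w = w \<otimes> x"
    using central[of x y] central[of x z] carr xy xz by blast
qed


section \<open>The semidihedral group\<close>

lemma presented_group_generator_pow: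
  "word_class R [l] [^]\<^bsub>presented_group R\<^esub> (k::nat) = word_class R (replicate k l)"
proof -
  interpret group "presented_group R"
    by (rule group_presented_group)
  show ?thesis
    by (induction k)
      (simp_all add: presented_group_one presented_group_mult flip: replicate_append_same)
qed

theorem theorem4p16:
  fixes n :: nat
  assumes "n \<ge> 2"
  shows "perfect_graph (with_proj (commuting_graph (semidihedral n)))"
proof -
  define G where "G = semidihedral n"
  interpret group G
    unfolding G_def by (rule group_semidihedral)
  let ?R = "sd_relators n"
  define a b where "a = word_class ?R [(Gen_a, True)]" and "b = word_class ?R [(Gen_b, True)]"
  define A where "A = generate G {a}"
  have a: "a \<in> carrier G" and b: "b \<in> carrier G"
    by (auto simp: G_def semidihedral_def presented_group_carrier a_def b_def)
  have A_eq: "A = {a [^]\<^bsub>G\<^esub> k | k :: int. k \<in> UNIV}"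
    unfolding A_def using generate_pow[OF a] by blast
  have A: "subgroup A G"
    unfolding A_def using a by (intro generate_is_subgroup) simp
  \<comment> \<open>The normal form writes \<open>x\<close> as a power of \<open>a\<close> times a
    power of \<open>b\<close> with exponent 0 or 1; exponent 0 would put \<open>x\<close> into
    \<open>A\<close>.\<close>
  have coset: "\<exists>u\<in>A. x = u \<otimes>\<^bsub>G\<^esub> b" if "x \<in> carrier G - A" for x
  proof -
    obtain w where w: "x = word_class ?R w"
      using \<open>x \<in> carrier G - A\<close> by (auto simp: G_def semidihedral_def presented_group_carrier)
    obtain i j where j: "j < 2" and "pres_eq ?R w (sd_normal i j)"
      using sd_normal_form[of n w] assms by auto
    then have x: "x = word_class ?R (replicate i (Gen_a, True)) \<otimes>\<^bsub>G\<^esub> word_class ?R (replicate j (Gen_b, True))"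
      by (simp add: w word_class_eq_iff sd_normal_def G_def semidihedral_def presented_group_mult)
    have pow: "word_class ?R (replicate i (Gen_a, True)) = a [^]\<^bsub>G\<^esub> int i"
      by (simp add: int_pow_int a_def G_def semidihedral_def presented_group_generator_pow)
    then have "word_class ?R (replicate i (Gen_a, True)) \<in> A"
      unfolding A_eq by blast
    moreover have "j \<noteq> 0"
    proof
      assume "j = 0"
      then have "x = a [^]\<^bsub>G\<^esub> int i"
        unfolding pow[symmetric] using x by (simp add: G_def semidihedral_def presented_group_mult)
      then show False
        using that by (auto simp: A_eq)
    qed
    ultimately show ?thesis
      using x j by (auto simp: b_def less_2_cases_iff)
  qed
  have "perfect_graph (with_proj (commuting_graph G))"
  proof (rule perfect_commuting_graph_if_abelian_index_2[OF _ A])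
    have "order G = 8 * n"
      unfolding G_def using assms by (intro order_semidihedral) simp
    then show "finite (carrier G)"
      \<comment> \<open>An infinite carrier would have \<open>card\<close> equal to 0, but the order
        is positive.\<close>
      using assms by (intro card_ge_0_finite) (simp add: order_def)
  next
    fix x y assume "x \<in> A" "y \<in> A"
    then show "x \<otimes>\<^bsub>G\<^esub> y = y \<otimes>\<^bsub>G\<^esub> x"
      unfolding A_eq using a by (auto simp: int_pow_mult[symmetric] ac_simps)
  next
    fix x y assume "x \<in> carrier G - A" "y \<in> carrier G - A"
    then obtain u v where uv: "u \<in> A" "x = u \<otimes>\<^bsub>G\<^esub> b" "v \<in> A" "y = v \<otimes>\<^bsub>G\<^esub> b"
      using coset by metis
    then have "u \<in> carrier G" "v \<in> carrier G"
      using subgroup.mem_carrier[OF A] by blast+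
    \<comment> \<open>The two factors \<open>b\<close> and \<open>inv b\<close> meet in the middle
      and cancel.\<close>
    then have "x \<otimes>\<^bsub>G\<^esub> inv\<^bsub>G\<^esub> y = u \<otimes>\<^bsub>G\<^esub> inv\<^bsub>G\<^esub> v"
      using b uv by (simp add: inv_mult_group inv_solve_right' flip: m_assoc)
    then show "x \<otimes>\<^bsub>G\<^esub> inv\<^bsub>G\<^esub> y \<in> A"
      using uv A by (simp add: subgroup.m_closed subgroup.m_inv_closed)
  qed
  then show ?thesis
    by (simp add: G_def)
qed

end
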